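(* Let $\mathcal{A} \subset \mathcal{P}(n)$ (for some $n$) be a union-closed family that contains at least one non-empty set, and suppose $|\mathcal{A}| = m \leq 36$. Then there exists an element belonging to at least half of the sets of $\mathcal{A}$.
   Context: $\mathcal{P}(n)$ is the power set of $\{1,\ldots,n\}$. A family $\mathcal{A}$ of sets is union-closed if $A \cup B \in \mathcal{A}$ for all $A,B \in \mathcal{A}$. *)

theory Defs
  imports Complex_Main
begin

definition union_closed :: "'a set set \<Rightarrow> bool" where
  "union_closed \<A> \<longleftrightarrow> (\<forall>A\<in>\<A>. \<forall>B\<in>\<A>. A \<union> B \<in> \<A>)"

end

theory Submission
  imports Defs
begin

text \<open>Consider a counterexample minimising first the number \<open>m\<close> of members and then the number \<open>n\<close>
  of elements; it separates its elements. For an element \<open>z\<close> let \<open>M z\<close> be the largest member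
  avoiding \<open>z\<close>. If \<open>x\<close> has maximal frequency, the subfamily avoiding \<open>x\<close> has by minimality an
  element \<open>y\<close> lying in half of it, and \<open>y\<close> can be chosen so that the \<open>n - 2\<close> sets \<open>M z\<close>
  (\<open>z \<noteq> x, y\<close>) and the ground set all contain both \<open>x\<close> and \<open>y\<close>. Counting gives \<open>m \<ge> 4n - 1\<close>,
  so \<open>n \<le> 9\<close>.

  For \<open>n \<le> 8\<close> the average size of a member is below \<open>n / 2\<close>, which forces many members of size 3;
  the unions of pairs of these are larger members, and there are too many of them because no set of
  size 4 contains three members of size 3.

  For \<open>n = 9\<close> the inequality \<open>m \<ge> 4n - 1\<close> is tight. The families of members containing \<open>x\<close> only,
  \<open>y\<close> only and neither have 9 members each, and every member containing both is the ground set or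
  some \<open>M z\<close>. By minimality some \<open>v\<close> lies in at least 5 of the members avoiding \<open>x\<close> and \<open>y\<close>. Any two
  members avoiding \<open>v\<close>, one containing only \<open>x\<close> and the other only \<open>y\<close>, have union \<open>M v\<close>, and this
  bounds the frequencies of all elements among the members avoiding \<open>x\<close> and \<open>y\<close> so strongly that
  some nonempty member has size at most 2, which is impossible.\<close>

section \<open>Frequencies and double counting\<close>

definition freq :: "'a set set \<Rightarrow> 'a \<Rightarrow> nat" where
  "freq F x = card {A \<in> F. x \<in> A}"

lemma sum_card_eq_sum_freq:
  assumes "finite F" "finite V" "\<And>A. A \<in> F \<Longrightarrow> A \<subseteq> V"
  shows "(\<Sum>A\<in>F. card A) = (\<Sum>x\<in>V. freq F x)"
proof -
  have "(\<Sum>A\<in>F. card A) = (\<Sum>A\<in>F. \<Sum>x\<in>V. if x \<in> A then 1 else 0)"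
  proof (rule sum.cong[OF refl])
    fix A assume "A \<in> F"
    then have "V \<inter> A = A" using assms(3) by blast
    then show "card A = (\<Sum>x\<in>V. if x \<in> A then 1 else 0)"
      using assms(2) by (simp add: sum.If_cases Int_def[symmetric] flip: Collect_mem_eq)
  qed
  also have "\<dots> = (\<Sum>x\<in>V. \<Sum>A\<in>F. if x \<in> A then 1 else 0)"
    by (rule sum.swap)
  also have "\<dots> = (\<Sum>x\<in>V. freq F x)"
    using assms(1) by (simp add: freq_def sum.If_cases Int_def)
  finally show ?thesis .
qed

lemma sum_by_card:
  fixes g :: "nat \<Rightarrow> nat"
  assumes "finite F" "\<And>A. A \<in> F \<Longrightarrow> card A \<le> k"
  shows "(\<Sum>A\<in>F. g (card A)) = (\<Sum>i\<le>k. g i * card {A \<in> F. card A = i})"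
proof -
  have "(\<Sum>i\<le>k. \<Sum>A\<in>{A \<in> F. card A = i}. g (card A)) = (\<Sum>A\<in>F. g (card A))"
    using assms by (intro sum.group) auto
  moreover have "(\<Sum>A\<in>{A \<in> F. card A = i}. g (card A)) = g i * card {A \<in> F. card A = i}" for i
    by simp
  ultimately show ?thesis by (simp add: mult.commute)
qed

section \<open>Union-closed families and local conditions for an abundant element\<close>

lemma union_closedD: "union_closed F \<Longrightarrow> A \<in> F \<Longrightarrow> B \<in> F \<Longrightarrow> A \<union> B \<in> F"
  by (auto simp: union_closed_def)

lemma Union_in_union_closed:
  assumes "union_closed F" "finite G" "G \<noteq> {}" "G \<subseteq> F"
  shows "\<Union>G \<in> F"
  using assms(2-4)
  by (induction rule: finite_ne_induct) (auto intro: union_closedD[OF assms(1)])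

text \<open>The hypothesis on \<open>H\<close> is applied to the traces on \<open>X\<close> of the members that agree
  outside \<open>X\<close>.\<close>

lemma local_criterion:
  assumes "finite F" "union_closed F" "finite X" "X \<noteq> {}"
    and trace: "\<And>H. \<lbrakk>H \<subseteq> Pow X; H \<noteq> {}; union_closed H;
        \<And>S g. \<lbrakk>S \<in> H; g \<in> F; g \<subseteq> X\<rbrakk> \<Longrightarrow> S \<union> g \<in> H\<rbrakk>
      \<Longrightarrow> card X * card H \<le> 2 * (\<Sum>S\<in>H. card S)"
  shows "\<exists>x\<in>X. card F \<le> 2 * freq F x"
proof -
  let ?fib = "\<lambda>R. {A \<in> F. A - X = R}"
  have fibre: "card X * card (?fib R) \<le> 2 * (\<Sum>A\<in>?fib R. card (A \<inter> X))"
    if "R \<in> (\<lambda>A. A - X) ` F" for R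
  proof -
    have inj: "inj_on (\<lambda>A. A \<inter> X) (?fib R)"
      by (rule inj_onI) blast
    let ?H = "(\<lambda>A. A \<inter> X) ` ?fib R"
    have "card X * card ?H \<le> 2 * (\<Sum>S\<in>?H. card S)"
    proof (rule trace)
      show "?H \<subseteq> Pow X" by blast
      show "?H \<noteq> {}" using that by blast
      show "union_closed ?H"
        unfolding union_closed_def
      proof (intro ballI)
        fix S T assume "S \<in> ?H" "T \<in> ?H"
        then obtain A B where AB: "A \<in> ?fib R" "S = A \<inter> X" "B \<in> ?fib R" "T = B \<inter> X" by blast
        then have "A \<union> B \<in> ?fib R" using union_closedD[OF assms(2)] by blast
        moreover have "S \<union> T = (A \<union> B) \<inter> X" using AB by blast
        ultimately show "S \<union> T \<in> ?H" by blast
      qed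
      fix S g assume "S \<in> ?H" "g \<in> F" "g \<subseteq> X"
      then obtain A where A: "A \<in> ?fib R" "S = A \<inter> X" by blast
      have "A \<union> g \<in> ?fib R" using union_closedD[OF assms(2)] A \<open>g \<in> F\<close> \<open>g \<subseteq> X\<close> by blast
      moreover have "S \<union> g = (A \<union> g) \<inter> X" using A \<open>g \<subseteq> X\<close> by blast
      ultimately show "S \<union> g \<in> ?H" by blast
    qed
    then show ?thesis using inj by (simp add: card_image sum.reindex)
  qed
  have "card X * card F = (\<Sum>R\<in>(\<lambda>A. A - X) ` F. card X * card (?fib R))"
    using sum.image_gen[OF assms(1), of "\<lambda>_. card X" "\<lambda>A. A - X"] by (simp add: mult.commute)
  also have "\<dots> \<le> (\<Sum>R\<in>(\<lambda>A. A - X) ` F. 2 * (\<Sum>A\<in>?fib R. card (A \<inter> X)))"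
    by (intro sum_mono fibre)
  also have "\<dots> = 2 * (\<Sum>A\<in>F. card (A \<inter> X))"
    using sum.image_gen[OF assms(1), of "\<lambda>A. card (A \<inter> X)" "\<lambda>A. A - X"]
    by (simp add: sum_distrib_left)
  also have "(\<Sum>A\<in>F. card (A \<inter> X)) = (\<Sum>A\<in>F. \<Sum>x\<in>X. if x \<in> A then 1 else 0)"
    using assms(3) by (simp add: sum.If_cases Int_commute)
  also have "\<dots> = (\<Sum>x\<in>X. \<Sum>A\<in>F. if x \<in> A then 1 else 0)"
    by (rule sum.swap)
  also have "\<dots> = (\<Sum>x\<in>X. freq F x)"
    using assms(1) by (simp add: freq_def sum.If_cases Int_def)
  finally have le: "card X * card F \<le> (\<Sum>x\<in>X. 2 * freq F x)"
    by (simp add: sum_distrib_left)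
  show ?thesis
  proof (rule ccontr)
    assume "\<not> ?thesis"
    then have "(\<Sum>x\<in>X. 2 * freq F x) < (\<Sum>x\<in>X. card F)"
      using assms(3,4) by (intro sum_strict_mono) auto
    then show False using le by simp
  qed
qed

text \<open>Give a trace \<open>S\<close> the weight \<open>2 * card S - card X\<close>. Every
  family of traces contains \<open>X\<close>, because \<open>X\<close> is itself a member, and
  \<open>X\<close> cancels the negative weight of the empty set; no other subset has negative
  weight, as \<open>card X \<le> 2\<close>.\<close>

lemma small_member_abundant:
  assumes "finite F" "union_closed F" "X \<in> F" "finite X" "X \<noteq> {}" "card X \<le> 2"
  shows "\<exists>x\<in>X. card F \<le> 2 * freq F x"
proof (rule local_criterion[OF assms(1,2,4,5)])
  fix H assume H: "H \<subseteq> Pow X" "H \<noteq> {}" "union_closed H"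
    and g: "\<And>S g. \<lbrakk>S \<in> H; g \<in> F; g \<subseteq> X\<rbrakk> \<Longrightarrow> S \<union> g \<in> H"
  have finH: "finite H" using H(1) assms(4) by (meson finite_Pow_iff finite_subset)
  obtain S where "S \<in> H" using H(2) by blast
  then have XH: "X \<in> H" using g[OF _ assms(3)] H(1) by (metis PowD subset_refl subsetD sup.absorb2)
  let ?f = "\<lambda>S. 2 * int (card S) - int (card X)"
  have pos: "0 \<le> ?f S" if "S \<in> H - {X, {}}" for S
  proof -
    have "S \<subseteq> X" "S \<noteq> {}" using that H(1) by auto
    then have "finite S" "S \<noteq> {}" using assms(4) finite_subset by auto
    then have "card S \<noteq> 0" by simp
    then show ?thesis using assms(6) by linarith
  qed
  have "0 \<le> sum ?f (H - {X, {}})" by (intro sum_nonneg pos)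
  moreover have "0 \<le> sum ?f (H \<inter> {X, {}})"
    using XH assms(5) by (cases "{} \<in> H") (auto simp: insert_absorb Int_insert_right)
  moreover have "sum ?f H = sum ?f (H \<inter> {X, {}}) + sum ?f (H - {X, {}})"
    by (rule sum.Int_Diff[OF finH])
  ultimately have "0 \<le> sum ?f H" by linarith
  then have "int (card X * card H) \<le> int (2 * (\<Sum>S\<in>H. card S))"
    by (simp add: sum_subtractf sum_distrib_left mult.commute)
  then show "card X * card H \<le> 2 * (\<Sum>S\<in>H. card S)" by linarith
qed

lemma card_3_in_4_avoiding:
  assumes "finite X" "card X = 4" "a \<in> X"
  shows "card {S. S \<subseteq> X \<and> card S = 3 \<and> a \<notin> S} \<le> 1"
proof -
  have "{S. S \<subseteq> X \<and> card S = 3 \<and> a \<notin> S} \<subseteq> {X - {a}}"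
  proof
    fix S assume S: "S \<in> {S. S \<subseteq> X \<and> card S = 3 \<and> a \<notin> S}"
    then have "S = X - {a}"
      using assms by (intro card_subset_eq) auto
    then show "S \<in> {X - {a}}" by simp
  qed
  then show ?thesis using card_mono[of "{X - {a}}"] by fastforce
qed

text \<open>In a trace, \<open>X\<close> itself outweighs the empty set, and every singleton is compensated by a triple.\<close>

lemma three_triples_in_four_abundant:
  assumes "finite F" "union_closed F" "finite X" "card X = 4"
    and "3 \<le> card {S \<in> F. S \<subseteq> X \<and> card S = 3}"
  shows "\<exists>x\<in>X. card F \<le> 2 * freq F x"
proof (rule local_criterion[OF assms(1,2,3)])
  show "X \<noteq> {}" using assms(4) by auto
  fix H assume H: "H \<subseteq> Pow X" "H \<noteq> {}" and uc: "union_closed H"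
    and g: "\<And>S g. \<lbrakk>S \<in> H; g \<in> F; g \<subseteq> X\<rbrakk> \<Longrightarrow> S \<union> g \<in> H"
  let ?T = "{S \<in> F. S \<subseteq> X \<and> card S = 3}"
  let ?h = "\<lambda>i. card {S \<in> H. card S = i}"
  have finH: "finite H" using H(1) assms(3) by (meson finite_Pow_iff finite_subset)
  have finT: "finite ?T" using assms(1) by simp
  have cardle: "card S \<le> 4" if "S \<in> H" for S
    using that H(1) assms(3,4) by (metis PowD card_mono subsetD)
  have sub: "finite S" if "S \<in> H" for S using that H(1) assms(3) by (auto dest: finite_subset)
  \<comment> \<open>Only one subset of \<open>X\<close> of size 3 misses \<open>a\<close>, so at
    least two of three triples contain it.\<close>
  have through: "2 \<le> card {S \<in> ?T. a \<in> S}" if "a \<in> X" for a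
  proof -
    have "card {S \<in> ?T. a \<notin> S} \<le> 1"
      using card_mono[OF _ , of "{S. S \<subseteq> X \<and> card S = 3 \<and> a \<notin> S}" "{S \<in> ?T. a \<notin> S}"]
        card_3_in_4_avoiding[OF assms(3,4) that] assms(3) by fastforce
    moreover have "card ?T = card {S \<in> ?T. a \<in> S} + card {S \<in> ?T. a \<notin> S}"
      using assms(1) by (subst card_Un_disjoint[symmetric]) (auto intro!: arg_cong[where f=card])
    ultimately show ?thesis using assms(5) by linarith
  qed
  have "X \<in> H"
  proof -
    obtain S where "S \<in> H" using H(2) by blast
    have ext: "S \<union> \<Union>G \<in> H" if "finite G" "G \<subseteq> ?T" for G
      using that
    proof (induction rule: finite_induct)
      case empty then show ?case using \<open>S \<in> H\<close> by simp
    next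
      case (insert t G)
      then have "(S \<union> \<Union>G) \<union> t \<in> H" by (intro g[of "S \<union> \<Union>G" t]) auto
      then show ?case by (simp add: Un_ac)
    qed
    have "X \<subseteq> \<Union>?T"
    proof
      fix a assume "a \<in> X"
      then have "0 < card {S \<in> ?T. a \<in> S}" using through[of a] by linarith
      then have "{S \<in> ?T. a \<in> S} \<noteq> {}" unfolding card_gt_0_iff by (rule conjunct1)
      then show "a \<in> \<Union>?T" by blast
    qed
    then have "S \<union> \<Union>?T = X" using \<open>S \<in> H\<close> H(1) by blast
    then show ?thesis using ext[OF finT] by simp
  qed
  have h4: "1 \<le> ?h 4"
  proof -
    have "X \<in> {S \<in> H. card S = 4}" using \<open>X \<in> H\<close> assms(4) by simp
    then have "0 < ?h 4" unfolding card_gt_0_iff using finH by auto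
    then show ?thesis by linarith
  qed
  have h0: "?h 0 \<le> 1" and h0': "{} \<notin> H \<Longrightarrow> ?h 0 = 0"
  proof -
    have *: "{S \<in> H. card S = 0} \<subseteq> H \<inter> {{}}" using sub by auto
    show "?h 0 \<le> 1" using card_mono[of "{{}}", OF _ order_trans[OF * Int_lower2]] by simp
    assume "{} \<notin> H"
    then have "{S \<in> H. card S = 0} = {}" using * by blast
    then show "?h 0 = 0" by (simp only: card.empty)
  qed
  have singles: "{S \<in> H. card S = 1} = (\<lambda>a. {a}) ` {a \<in> X. {a} \<in> H}"
    using H(1) by (auto simp: card_1_singleton_iff)
  have h1: "?h 1 = card {a \<in> X. {a} \<in> H}"
    unfolding singles by (rule card_image) simp
  have h1le: "?h 1 \<le> 4" unfolding h1 using assms(3,4) card_mono[of X "{a \<in> X. {a} \<in> H}"] by auto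
  have h3_0: "3 \<le> ?h 3" if "{} \<in> H"
  proof -
    have "?T \<subseteq> {S \<in> H. card S = 3}" using g[OF that] by auto
    from card_mono[OF _ this] show ?thesis using finH assms(5) by simp
  qed
  have h3_1: "2 \<le> ?h 3" if pos: "0 < ?h 1"
  proof -
    obtain a where a: "a \<in> X" "{a} \<in> H" using pos unfolding h1 by (auto simp: card_gt_0_iff)
    have "S \<in> H" if "S \<in> ?T" "a \<in> S" for S using g[OF a(2), of S] that by (simp add: insert_absorb)
    then have "{S \<in> ?T. a \<in> S} \<subseteq> {S \<in> H. card S = 3}" by auto
    from card_mono[OF _ this] show ?thesis using finH through[OF a(1)] by simp
  qed
  have h3_4: "4 \<le> ?h 3" if "?h 1 = 4"
  proof -
    have "{a \<in> X. {a} \<in> H} = X" using that assms(3,4) unfolding h1 by (intro card_subset_eq) auto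
    then have all: "{a} \<in> H" if "a \<in> X" for a using that by blast
    have "(\<lambda>a. X - {a}) ` X \<subseteq> {S \<in> H. card S = 3}"
    proof (rule image_subsetI)
      fix a assume "a \<in> X"
      then have c: "card (X - {a}) = 3" using assms(3,4) by simp
      then have "X - {a} \<noteq> {}" by (metis card.empty zero_neq_numeral)
      then have "\<Union>((\<lambda>a. {a}) ` (X - {a})) \<in> H"
        using assms(3) all by (intro Union_in_union_closed[OF uc]) blast+
      then show "X - {a} \<in> {S \<in> H. card S = 3}" using c by simp
    qed
    from card_mono[OF _ this] have "card ((\<lambda>a. X - {a}) ` X) \<le> ?h 3"
      using finH by simp
    moreover have "card ((\<lambda>a. X - {a}) ` X) = 4"
      using assms(4) by (subst card_image) (auto simp: inj_on_def)
    ultimately show ?thesis by simp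
  qed
  \<comment> \<open>These are the weights \<open>2 * card S - 4\<close>, halved. If
    \<open>{}\<close> is in \<open>H\<close>, then \<open>X\<close> pays for it, and three triples
    pay for up to three singletons. Otherwise \<open>X\<close> and two triples do so. Four
    singletons always come with four triples.\<close>
  have "2 * ?h 0 + ?h 1 \<le> ?h 3 + 2 * ?h 4"
    using h0 h0' h1le h3_0 h3_1 h3_4 h4 by (cases "{} \<in> H"; cases "?h 1 = 0"; cases "?h 1 = 4") linarith+
  moreover have "card H = ?h 0 + ?h 1 + ?h 2 + ?h 3 + ?h 4"
    using sum_by_card[OF finH cardle, of "\<lambda>_. 1"] by (simp add: eval_nat_numeral)
  moreover have "(\<Sum>S\<in>H. card S) = ?h 1 + 2 * ?h 2 + 3 * ?h 3 + 4 * ?h 4"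
    using sum_by_card[OF finH cardle, of "\<lambda>i. i"] by (simp add: eval_nat_numeral)
  ultimately show "card X * card H \<le> 2 * (\<Sum>S\<in>H. card S)"
    unfolding assms(4) by linarith
qed

section \<open>Counting subsets of small sets\<close>

text \<open>\<open>B\<close> must contain both points of \<open>C - A\<close>, hence exactly one of
  the three points of \<open>A\<close>.\<close>

lemma card_triples_completing_five:
  assumes "finite C" "A \<subseteq> C" "card A = 3" "card C = 5"
  shows "card {B. B \<subseteq> C \<and> card B = 3 \<and> A \<union> B = C} \<le> 3"
proof -
  have finA: "finite A" using assms(1,2) finite_subset by blast
  have CA: "card (C - A) = 2" using assms finA by (simp add: card_Diff_subset)
  have "{B. B \<subseteq> C \<and> card B = 3 \<and> A \<union> B = C} \<subseteq> (\<lambda>a. insert a (C - A)) ` A"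
  proof
    fix B assume "B \<in> {B. B \<subseteq> C \<and> card B = 3 \<and> A \<union> B = C}"
    then have B: "B \<subseteq> C" "card B = 3" "A \<union> B = C" by auto
    have "finite B" using B(1) assms(1) finite_subset by blast
    moreover have "B = (C - A) \<union> (B \<inter> A)" using B by blast
    moreover have "(C - A) \<inter> (B \<inter> A) = {}" by blast
    ultimately have "card B = card (C - A) + card (B \<inter> A)"
      using assms(1) by (metis card_Un_disjoint finite_Diff finite_Int)
    then have "card (B \<inter> A) = 1" using B(2) CA by linarith
    then obtain a where "B \<inter> A = {a}" by (rule card_1_singletonE)
    then show "B \<in> (\<lambda>a. insert a (C - A)) ` A" using B by blast
  qed
  then show ?thesis
    using surj_card_le[OF finA] assms(3) by fastforce
qed

lemma card_triples_completing_six: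
  assumes "finite C" "A \<subseteq> C" "card A = 3" "card C = 6"
  shows "card {B. B \<subseteq> C \<and> card B = 3 \<and> A \<union> B = C} \<le> 1"
proof -
  have CA: "card (C - A) = 3" using assms finite_subset[of A C] by (simp add: card_Diff_subset)
  have "{B. B \<subseteq> C \<and> card B = 3 \<and> A \<union> B = C} \<subseteq> {C - A}"
  proof
    fix B assume "B \<in> {B. B \<subseteq> C \<and> card B = 3 \<and> A \<union> B = C}"
    then have B: "B \<subseteq> C" "card B = 3" "A \<union> B = C" by auto
    have "C - A = B"
      using B CA assms(1) finite_subset[of B C] by (intro card_subset_eq) auto
    then show "B \<in> {C - A}" by simp
  qed
  then show ?thesis using card_mono[of "{C - A}"] by fastforce
qed

text \<open>Count pairs of a set in \<open>T\<close> and a point of \<open>C\<close> outside it: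
  each set misses two points, and each \<open>c\<close> is missed by at most two sets, which lie in
  the 4-set \<open>C - {c}\<close>. So \<open>2 * card T \<le> 10\<close>.\<close>

lemma triples_in_five:
  assumes "finite C" "card C = 5" "finite T" "\<And>A. A \<in> T \<Longrightarrow> A \<subseteq> C \<and> card A = 3"
    and four: "\<And>X. X \<subseteq> C \<Longrightarrow> card X = 4 \<Longrightarrow> card {A \<in> T. A \<subseteq> X} \<le> 2"
  shows "card T \<le> 5"
proof -
  have "2 * card T = (\<Sum>A\<in>T. card (C - A))"
  proof -
    have "card (C - A) = 2" if "A \<in> T" for A
      using assms(4)[OF that] assms(1,2) finite_subset[of A C] by (simp add: card_Diff_subset)
    then show ?thesis by simp
  qed
  also have "\<dots> = (\<Sum>A\<in>T. \<Sum>c\<in>C. if c \<notin> A then 1 else 0)"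
    using assms(1) by (simp add: sum.If_cases Diff_eq Compl_eq)
  also have "\<dots> = (\<Sum>c\<in>C. \<Sum>A\<in>T. if c \<notin> A then 1 else 0)"
    by (rule sum.swap)
  also have "\<dots> = (\<Sum>c\<in>C. card {A \<in> T. c \<notin> A})"
    using assms(3) by (simp add: sum.If_cases Int_def)
  also have "\<dots> \<le> (\<Sum>c\<in>C. 2)"
  proof (rule sum_mono)
    fix c assume "c \<in> C"
    then have "{A \<in> T. c \<notin> A} = {A \<in> T. A \<subseteq> C - {c}}" using assms(4) by blast
    then show "card {A \<in> T. c \<notin> A} \<le> 2"
      using four[of "C - {c}"] \<open>c \<in> C\<close> assms(1,2) by auto
  qed
  finally show ?thesis using assms(2) by simp
qed

text \<open>Two points have only four subsets, so both unions have at least three points; being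
  disjoint, they exhaust \<open>N\<close>.\<close>

lemma disjoint_families_cover:
  assumes "finite N" "card N \<le> 6" "\<P> \<subseteq> Pow N" "\<Q> \<subseteq> Pow N" "5 \<le> card \<P>" "5 \<le> card \<Q>"
    and disj: "\<And>c d. c \<in> \<P> \<Longrightarrow> d \<in> \<Q> \<Longrightarrow> c \<inter> d = {}"
  shows "\<Union>\<P> \<union> \<Union>\<Q> = N"
proof -
  have large: "3 \<le> card (\<Union>\<S>)" if "\<S> \<subseteq> Pow N" "5 \<le> card \<S>" for \<S>
  proof (rule ccontr)
    assume "\<not> 3 \<le> card (\<Union>\<S>)"
    then have "(2::nat) ^ card (\<Union>\<S>) \<le> 2 ^ 2" by (intro power_increasing) auto
    moreover have "finite (\<Union>\<S>)" using that(1) assms(1) by (meson Sup_le_iff PowD finite_subset subsetD)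
    then have "card \<S> \<le> 2 ^ card (\<Union>\<S>)"
      using card_mono[of "Pow (\<Union>\<S>)" \<S>] by (auto simp: card_Pow)
    ultimately show False using that(2) by simp
  qed
  have sub: "\<Union>\<P> \<subseteq> N" "\<Union>\<Q> \<subseteq> N" using assms by auto
  then have "finite (\<Union>\<P>)" "finite (\<Union>\<Q>)" using assms(1) by (auto intro: finite_subset)
  moreover have "\<Union>\<P> \<inter> \<Union>\<Q> = {}" using disj by blast
  ultimately have "card (\<Union>\<P> \<union> \<Union>\<Q>) = card (\<Union>\<P>) + card (\<Union>\<Q>)" by (rule card_Un_disjoint)
  then have "card N \<le> card (\<Union>\<P> \<union> \<Union>\<Q>)" using large[of \<P>] large[of \<Q>] assms by linarith
  then show ?thesis using sub assms(1) by (intro card_seteq) auto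
qed

section \<open>Minimal counterexamples\<close>

text \<open>\<open>minimal\<close> expresses minimality in the number of members, for proper
  subfamilies; minimality in the number of elements enters as \<open>separating\<close>.\<close>

locale minimal_counterexample =
  fixes F :: "'a set set"
  assumes finite_Union: "finite (\<Union>F)"
    and union_closed: "union_closed F"
    and nonempty_member: "\<exists>A\<in>F. A \<noteq> {}"
    and card_le_36: "card F \<le> 36"
    and rare: "x \<in> \<Union>F \<Longrightarrow> 2 * freq F x < card F"
    and separating: "\<lbrakk>x \<in> \<Union>F; y \<in> \<Union>F; {A \<in> F. x \<in> A} = {A \<in> F. y \<in> A}\<rbrakk> \<Longrightarrow> x = y"
    and minimal: "\<lbrakk>G \<subset> F; union_closed G; \<exists>A\<in>G. A \<noteq> {}\<rbrakk>
      \<Longrightarrow> \<exists>x\<in>\<Union>G. card G \<le> 2 * freq G x"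
begin

abbreviation V where "V \<equiv> \<Union>F"

definition M where "M z = \<Union>{A \<in> F. z \<notin> A}"

text \<open>Here \<open>z\<close> dominates \<open>v\<close> if every member containing \<open>v\<close> contains \<open>z\<close>, that is, \<open>v \<notin> M z\<close>.\<close>

definition undominated where "undominated v \<longleftrightarrow> v \<in> V \<and> (\<forall>z\<in>V. z \<noteq> v \<longrightarrow> v \<in> M z)"

lemma finite_F: "finite F"
  using finite_Union by (rule finite_UnionD)

lemma finite_member: "A \<in> F \<Longrightarrow> finite A"
  using finite_Union by (meson Union_upper finite_subset)

lemma V_in_F: "V \<in> F"
  using nonempty_member by (intro Union_in_union_closed[OF union_closed finite_F]) auto

lemma V_nonempty: "V \<noteq> {}"
  using nonempty_member by blast

lemma freq_pos: "x \<in> V \<Longrightarrow> 0 < freq F x"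
  using finite_F by (auto simp: freq_def card_gt_0_iff)

lemma member_card_ge_3:
  assumes "A \<in> F" "A \<noteq> {}" shows "3 \<le> card A"
proof (rule ccontr)
  assume "\<not> 3 \<le> card A"
  then obtain x where "x \<in> A" "card F \<le> 2 * freq F x"
    using small_member_abundant[OF finite_F union_closed assms(1) finite_member[OF assms(1)] assms(2)]
    by auto
  then show False using rare[of x] assms(1) by auto
qed

lemma triples_in_four:
  assumes "X \<subseteq> V" "card X = 4"
  shows "card {S \<in> F. S \<subseteq> X \<and> card S = 3} \<le> 2"
proof (rule ccontr)
  assume "\<not> ?thesis"
  then obtain x where "x \<in> X" "card F \<le> 2 * freq F x"
    using three_triples_in_four_abundant[OF finite_F union_closed _ assms(2)]
      finite_subset[OF assms(1) finite_Union] by auto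
  then show False using rare[of x] assms(1) by auto
qed

section \<open>Largest avoiding members and domination\<close>

lemma M_subset: "M z \<subseteq> V"
  by (auto simp: M_def)

lemma not_in_M: "z \<notin> M z"
  by (auto simp: M_def)

lemma M_in_F:
  assumes "z \<in> V" shows "M z \<in> F"
proof -
  have "{A \<in> F. z \<notin> A} \<noteq> {}"
  proof
    assume "{A \<in> F. z \<notin> A} = {}"
    then have "{A \<in> F. z \<in> A} = F" by blast
    then show False using rare[OF assms] by (simp add: freq_def)
  qed
  then show ?thesis unfolding M_def
    using finite_F by (intro Union_in_union_closed[OF union_closed]) auto
qed

lemma M_proper: "z \<in> V \<Longrightarrow> M z \<subset> V"
  using M_subset not_in_M by blast

lemma in_M_iff: "w \<in> M z \<longleftrightarrow> \<not> {A \<in> F. w \<in> A} \<subseteq> {A \<in> F. z \<in> A}"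
  by (auto simp: M_def)

lemma dominated_eq:
  assumes "{A \<in> F. v \<in> A} \<subseteq> {A \<in> F. w \<in> A}" "freq F w \<le> freq F v" "v \<in> V" "w \<in> V"
  shows "v = w"
  using assms finite_F
  by (intro separating card_seteq) (auto simp: freq_def)

lemma in_M_if_freq_le:
  assumes "z \<in> V" "w \<in> V" "w \<noteq> z" "freq F z \<le> freq F w"
  shows "w \<in> M z"
  using dominated_eq assms unfolding in_M_iff by blast

text \<open>If \<open>M z = M w\<close>, this set contains neither element, so \<open>z\<close> and
  \<open>w\<close> dominate each other.\<close>

lemma inj_on_M: "inj_on M V"
proof (rule inj_onI)
  fix z w assume "z \<in> V" "w \<in> V" "M z = M w"
  then have "{A \<in> F. w \<in> A} = {A \<in> F. z \<in> A}"
    using not_in_M[of z] not_in_M[of w] in_M_iff[of w z] in_M_iff[of z w] by (intro subset_antisym) simp_all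
  then show "z = w" using separating \<open>z \<in> V\<close> \<open>w \<in> V\<close> by metis
qed

text \<open>Among the elements dominating \<open>v\<close>, take \<open>w\<close> of largest
  frequency. Whatever dominates \<open>w\<close> also dominates \<open>v\<close>, so it is no more
  frequent than \<open>w\<close> and equals it.\<close>

lemma ex_undominated_above:
  assumes "v \<in> V"
  obtains w where "undominated w" "{A \<in> F. v \<in> A} \<subseteq> {A \<in> F. w \<in> A}"
proof -
  let ?S = "{w \<in> V. {A \<in> F. v \<in> A} \<subseteq> {A \<in> F. w \<in> A}}"
  have "finite ?S" by (rule finite_subset[OF _ finite_Union]) blast
  moreover have "?S \<noteq> {}" using assms by blast
  ultimately have "Max (freq F ` ?S) \<in> freq F ` ?S" by (intro Max_in) auto
  then obtain w where w: "Max (freq F ` ?S) = freq F w" "w \<in> ?S" by (rule imageE)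
  have w_max: "freq F u \<le> freq F w" if "u \<in> ?S" for u
    unfolding w(1)[symmetric] using \<open>finite ?S\<close> that by (intro Max_ge) auto
  have "w \<in> M z" if "z \<in> V" "z \<noteq> w" for z
  proof (rule ccontr)
    assume "w \<notin> M z"
    then have sub: "{A \<in> F. w \<in> A} \<subseteq> {A \<in> F. z \<in> A}" unfolding in_M_iff by blast
    then have "z \<in> ?S" using w(2) that by blast
    then show False using dominated_eq[OF sub w_max] w(2) that by blast
  qed
  then have "undominated w" using w(2) by (auto simp: undominated_def)
  then show thesis using that w(2) by blast
qed

lemma undominatedD:
  assumes "undominated v" shows "v \<in> V" "z \<in> V \<Longrightarrow> z \<noteq> v \<Longrightarrow> v \<in> M z"
  using assms by (auto simp: undominated_def)

text \<open>The sets \<open>M z\<close> with \<open>z\<close> other than \<open>x\<close> and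
  \<open>y\<close> contain both, as these are undominated. They are distinct by injectivity and
  proper, so \<open>V\<close> is one more.\<close>

lemma common_members:
  assumes "undominated x" "undominated y" "x \<noteq> y"
  shows "insert V (M ` (V - {x, y})) \<subseteq> {A \<in> F. x \<in> A \<and> y \<in> A}"
    and "card (insert V (M ` (V - {x, y}))) = card V - 1"
    and "card V - 1 \<le> card {A \<in> F. x \<in> A \<and> y \<in> A}"
proof -
  show 1: "insert V (M ` (V - {x, y})) \<subseteq> {A \<in> F. x \<in> A \<and> y \<in> A}"
    using undominatedD[OF assms(1)] undominatedD[OF assms(2)] V_in_F M_in_F by auto
  have xy: "x \<in> V" "y \<in> V" using assms undominatedD by auto
  have "card (M ` (V - {x, y})) = card (V - {x, y})"
    by (rule card_image) (meson Diff_subset inj_on_M inj_on_subset)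
  also have "\<dots> = card V - 2"
    using xy assms(3) finite_Union by (subst card_Diff_subset) auto
  moreover have "V \<notin> M ` (V - {x, y})" using M_proper by blast
  moreover have "2 \<le> card V" using card_mono[OF finite_Union, of "{x, y}"] xy assms(3) by auto
  ultimately show 2: "card (insert V (M ` (V - {x, y}))) = card V - 1"
    using finite_Union by simp
  show "card V - 1 \<le> card {A \<in> F. x \<in> A \<and> y \<in> A}"
    using card_mono[OF _ 1] finite_F 2 by simp
qed

section \<open>Partners and frequencies of undominated elements\<close>

lemma card_F_split: "card F = card {A \<in> F. P A} + card {A \<in> F. \<not> P A}"
  using finite_F by (subst card_Un_disjoint[symmetric]) (auto intro!: arg_cong[where f=card])

lemma freq_split: "freq F y = card {A \<in> F. x \<in> A \<and> y \<in> A} + card {A \<in> F. x \<notin> A \<and> y \<in> A}"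
  unfolding freq_def
  using finite_F by (subst card_Un_disjoint[symmetric]) (auto intro!: arg_cong[where f=card])

text \<open>Minimality gives some \<open>v\<close> in half of the members avoiding \<open>x\<close>.
  An undominated \<open>y\<close> above \<open>v\<close> is at least as frequent there, and is not
  \<open>x\<close> because \<open>v\<close> lies in a member avoiding \<open>x\<close>.\<close>

lemma ex_partner:
  assumes "undominated x"
  obtains y where "undominated y" "y \<noteq> x"
    "card F \<le> freq F x + 2 * card {A \<in> F. x \<notin> A \<and> y \<in> A}"
proof -
  let ?G = "{A \<in> F. x \<notin> A}"
  have x: "x \<in> V" using assms undominatedD by blast
  have split: "card F = freq F x + card ?G" using card_F_split[of "\<lambda>A. x \<in> A"] by (simp add: freq_def)
  have "2 \<le> card ?G" using split rare[OF x] freq_pos[OF x] by linarith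
  then have G3: "\<exists>A\<in>?G. A \<noteq> {}"
    using card_mono[of "{{}}" ?G] by fastforce
  have G1: "?G \<subset> F" using x by blast
  have G2: "union_closed ?G" using union_closed by (auto simp: union_closed_def)
  obtain v where v: "v \<in> \<Union>?G" "card ?G \<le> 2 * freq ?G v"
    using minimal[OF G1 G2 G3] by (rule bexE)
  then have "v \<in> V" by blast
  then obtain y where y: "undominated y" "{A \<in> F. v \<in> A} \<subseteq> {A \<in> F. y \<in> A}"
    by (rule ex_undominated_above)
  have "y \<noteq> x" using v(1) y(2) by blast
  moreover have "freq ?G v \<le> card {A \<in> F. x \<notin> A \<and> y \<in> A}"
    unfolding freq_def using finite_F y(2) by (intro card_mono) auto
  ultimately show thesis using that[OF y(1)] v(2) split by linarith
qed

text \<open>\<open>x\<close> and its partner \<open>y\<close> share at least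
  \<open>card V - 1\<close> members, so
  \<open>card F \<le> freq F x + 2 * freq F y - 2 * (card V - 1)\<close>, while
  \<open>2 * freq F y < card F\<close>. With rarity of \<open>x\<close> this becomes
  \<open>4 * card V - 1 \<le> card F\<close>.\<close>

lemma freq_undominated_ge:
  assumes "undominated x" shows "2 * card V \<le> freq F x + 1"
proof -
  obtain y where y: "undominated y" "y \<noteq> x"
    "card F \<le> freq F x + 2 * card {A \<in> F. x \<notin> A \<and> y \<in> A}"
    using ex_partner[OF assms] by blast
  have "2 * freq F y < card F" using y undominatedD rare by blast
  then show ?thesis
    using y(3) common_members(3)[OF assms y(1)] y(2) freq_split[of y x] by auto
qed

lemma ex_undominated: obtains x where "undominated x"
  using V_nonempty ex_undominated_above by blast

subsection \<open>At most eight elements\<close>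

text \<open>Count ordered pairs of distinct triples by their union. A 4-set contains at most two
  triples; a 5-set at most five, with three partners each; in a 6-set each of at most 20 triples
  pairs only with its complement.\<close>

lemma triple_pairs:
  assumes "card V \<le> 8"
  defines "a \<equiv> \<lambda>i. card {A \<in> F. card A = i}"
  shows "a 3 * (a 3 - 1) \<le> 2 * a 4 + 15 * a 5 + 20 * a 6"
proof -
  let ?T = "{A \<in> F. card A = 3}"
  let ?D = "SIGMA A:?T. ?T - {A}"
  let ?g = "\<lambda>i::nat. if i = 4 then 2 else if i = 5 then 15 else if i = 6 then 20 else (0::nat)"
  have finT: "finite ?T" using finite_F by simp
  have finD: "finite ?D" using finT by simp
  have bound: "card {p \<in> ?D. fst p \<union> snd p = C} \<le> ?g (card C)" if "C \<in> F" for C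
  proof (cases "{p \<in> ?D. fst p \<union> snd p = C} = {}")
    case True
    then show ?thesis by (simp only: card.empty)
  next
    case False
    have finC: "finite C" using finite_member[OF that] .
    let ?TC = "{A \<in> ?T. A \<subseteq> C}"
    let ?B = "\<lambda>A. {B \<in> ?TC. B \<noteq> A \<and> A \<union> B = C}"
    have finTC: "finite ?TC" using finite_F by simp
    have "{p \<in> ?D. fst p \<union> snd p = C} = (SIGMA A:?TC. ?B A)" by auto
    then have N: "card {p \<in> ?D. fst p \<union> snd p = C} = (\<Sum>A\<in>?TC. card (?B A))"
      using finite_F by simp
    obtain A B where AB: "A \<in> ?T" "B \<in> ?T" "A \<noteq> B" "A \<union> B = C" using False by auto
    have fAB: "finite A" "finite B" using AB finite_member by auto
    have "A \<noteq> C" using AB fAB card_seteq[of A B] by auto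
    then have "A \<subset> C" using AB by blast
    from psubset_card_mono[OF finC this] have "3 < card C" using AB(1) by simp
    moreover have "card C \<le> 6" using card_Un_le[of A B] AB(1,2) unfolding AB(4) by simp
    ultimately consider "card C = 4" | "card C = 5" | "card C = 6" by linarith
    then show ?thesis
    proof cases
      case 1
      have eq: "?TC = {S \<in> F. S \<subseteq> C \<and> card S = 3}" by auto
      have t: "card ?TC \<le> 2" unfolding eq using triples_in_four[of C] 1 that by blast
      have "card (?B A) \<le> 1" if "A \<in> ?TC" for A
      proof -
        have "card (?B A) \<le> card (?TC - {A})" using finTC by (intro card_mono) auto
        then show ?thesis using t finTC that by simp
      qed
      from sum_bounded_above[of ?TC "\<lambda>A. card (?B A)", OF this]
      have "(\<Sum>A\<in>?TC. card (?B A)) \<le> card ?TC * 1" unfolding of_nat_id .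
      then show ?thesis using 1 t unfolding N by simp
    next
      case 2
      have "card ?TC \<le> 5"
      proof (rule triples_in_five[OF finC 2 finTC])
        fix X assume X: "X \<subseteq> C" "card X = 4"
        have "{A \<in> ?TC. A \<subseteq> X} = {S \<in> F. S \<subseteq> X \<and> card S = 3}" using X by auto
        then show "card {A \<in> ?TC. A \<subseteq> X} \<le> 2" using triples_in_four[of X] X that by auto
      qed auto
      moreover have "card (?B A) \<le> 3" if "A \<in> ?TC" for A
      proof -
        have "card (?B A) \<le> card {B. B \<subseteq> C \<and> card B = 3 \<and> A \<union> B = C}"
          using finC by (intro card_mono) auto
        then show ?thesis using card_triples_completing_five[OF finC _ _ 2, of A] that by simp
      qed
      from sum_bounded_above[of ?TC "\<lambda>A. card (?B A)", OF this]
      have "(\<Sum>A\<in>?TC. card (?B A)) \<le> card ?TC * 3" unfolding of_nat_id .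
      ultimately show ?thesis using 2 unfolding N by simp
    next
      case 3
      have "card ?TC \<le> card {S. S \<subseteq> C \<and> card S = 3}" using finC by (intro card_mono) auto
      also have "\<dots> = 20" using n_subsets[OF finC, of 3] 3 by (simp add: eval_nat_numeral)
      finally have "card ?TC \<le> 20" .
      moreover have "card (?B A) \<le> 1" if "A \<in> ?TC" for A
      proof -
        have "card (?B A) \<le> card {B. B \<subseteq> C \<and> card B = 3 \<and> A \<union> B = C}"
          using finC by (intro card_mono) auto
        then show ?thesis using card_triples_completing_six[OF finC _ _ 3, of A] that by simp
      qed
      from sum_bounded_above[of ?TC "\<lambda>A. card (?B A)", OF this]
      have "(\<Sum>A\<in>?TC. card (?B A)) \<le> card ?TC * 1" unfolding of_nat_id .
      ultimately show ?thesis using 3 unfolding N by simp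
    qed
  qed
  have "a 3 * (a 3 - 1) = card ?D"
    using finT by (simp add: a_def)
  also have "\<dots> = (\<Sum>C\<in>F. card {p \<in> ?D. fst p \<union> snd p = C})"
  proof -
    have "(\<Sum>C\<in>F. sum (\<lambda>_. 1::nat) {p \<in> ?D. fst p \<union> snd p = C}) = sum (\<lambda>_. 1) ?D"
      using finD finite_F union_closedD[OF union_closed] by (intro sum.group) auto
    then show ?thesis by simp
  qed
  also have "\<dots> \<le> (\<Sum>C\<in>F. ?g (card C))" by (intro sum_mono bound)
  also have "\<dots> = (\<Sum>i\<le>8. ?g i * a i)"
    unfolding a_def
    by (rule sum_by_card[OF finite_F])
      (meson Union_upper assms(1) card_mono finite_Union order_trans)
  also have "\<dots> = 2 * a 4 + 15 * a 5 + 20 * a 6"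
    by (simp add: eval_nat_numeral)
  finally show ?thesis .
qed

text \<open>An element of least frequency in \<open>S\<close> dominates no other element of
  \<open>S\<close>.\<close>

lemma ex_large_M:
  assumes "S \<subseteq> V" "S \<noteq> {}"
  obtains z where "z \<in> S" "S - {z} \<subseteq> M z"
proof -
  have "finite S" using assms(1) finite_Union finite_subset by blast
  then have "Min (freq F ` S) \<in> freq F ` S" using assms(2) by (intro Min_in) auto
  then obtain z where z: "z \<in> S" "freq F z = Min (freq F ` S)" by auto
  have "w \<in> M z" if "w \<in> S - {z}" for w
  proof (rule in_M_if_freq_le)
    show "freq F z \<le> freq F w" unfolding z(2) using \<open>finite S\<close> that by (intro Min_le) auto
  qed (use that z assms(1) in auto)
  then show thesis using that z(1) by blast
qed

text \<open>Removing an element of least frequency three times yields distinct members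
  \<open>M z1\<close>, \<open>M z2\<close>, \<open>M z3\<close> of sizes at least 7, 6, 5, which
  contribute 3 + 2 + 1.\<close>

lemma large_members:
  assumes "card V = 8"
  defines "a \<equiv> \<lambda>i. card {A \<in> F. card A = i}"
  shows "1 \<le> a 7" "6 \<le> a 5 + 2 * a 6 + 3 * a 7"
proof -
  obtain z1 where z1: "z1 \<in> V" "V - {z1} \<subseteq> M z1"
    using ex_large_M[OF subset_refl V_nonempty] by blast
  have c1: "card (V - {z1}) = 7" using z1(1) assms(1) finite_Union by simp
  then have "V - {z1} \<noteq> {}" by (metis card.empty zero_neq_numeral)
  then obtain z2 where z2: "z2 \<in> V - {z1}" "V - {z1} - {z2} \<subseteq> M z2"
    using ex_large_M[of "V - {z1}"] by blast
  have c2: "card (V - {z1} - {z2}) = 6" using z2(1) c1 finite_Union by simp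
  then have "V - {z1} - {z2} \<noteq> {}" by (metis card.empty zero_neq_numeral)
  then obtain z3 where z3: "z3 \<in> V - {z1} - {z2}" "V - {z1} - {z2} - {z3} \<subseteq> M z3"
    using ex_large_M[of "V - {z1} - {z2}"] by blast
  have c3: "card (V - {z1} - {z2} - {z3}) = 5" using z3(1) c2 finite_Union by simp
  have finM: "finite (M z)" for z using finite_subset[OF M_subset finite_Union] .
  have le7: "card (M z) \<le> 7" if "z \<in> V" for z
    using psubset_card_mono[OF finite_Union M_proper[OF that]] assms(1) by simp
  have M: "card (M z1) = 7" "6 \<le> card (M z2)" "card (M z2) \<le> 7" "5 \<le> card (M z3)" "card (M z3) \<le> 7"
    using card_mono[OF finM z1(2)] card_mono[OF finM z2(2)] card_mono[OF finM z3(2)] c1 c2 c3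
      le7[of z1] le7[of z2] le7[of z3] z1 z2 z3 by auto
  have "M z1 \<in> {A \<in> F. card A = 7}" using M(1) M_in_F z1(1) by simp
  then have "0 < a 7" unfolding a_def card_gt_0_iff using finite_F by auto
  then show "1 \<le> a 7" by simp
  \<comment> \<open>Truncated subtraction gives weight 0 up to size 4; the case 8 leaves out
    \<open>V\<close>.\<close>
  let ?g = "\<lambda>i::nat. if i = 8 then 0 else i - 4"
  have distinct: "M z1 \<noteq> M z2" "M z1 \<noteq> M z3" "M z2 \<noteq> M z3"
    using z1 z2 z3 by (auto dest!: inj_onD[OF inj_on_M])
  have "6 \<le> (\<Sum>A\<in>{M z1, M z2, M z3}. ?g (card A))"
    using M distinct by simp
  also have "\<dots> \<le> (\<Sum>A\<in>F. ?g (card A))"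
    using finite_F M_in_F z1 z2 z3 by (intro sum_mono2) auto
  also have "\<dots> = (\<Sum>i\<le>8. ?g i * a i)"
    unfolding a_def
    by (rule sum_by_card[OF finite_F])
      (metis Union_upper assms(1) card_mono finite_Union)
  also have "\<dots> = a 5 + 2 * a 6 + 3 * a 7"
    by (simp add: eval_nat_numeral)
  finally show "6 \<le> a 5 + 2 * a 6 + 3 * a 7" .
qed

lemma card_V_ge_9: "9 \<le> card V"
proof (rule ccontr)
  assume "\<not> 9 \<le> card V"
  then have n8: "card V \<le> 8" by simp
  define a where "a = (\<lambda>i. card {A \<in> F. card A = i})"
  have cardV: "card A \<le> card V" if "A \<in> F" for A
    using that finite_Union by (meson Union_upper card_mono)
  then have card8: "card A \<le> 8" if "A \<in> F" for A using that n8 order_trans by blast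
  have a0: "a 0 \<le> 1"
  proof -
    have "{A \<in> F. card A = 0} \<subseteq> {{}}" using finite_member by auto
    from card_mono[OF _ this] show ?thesis by (simp add: a_def)
  qed
  have a12: "a i = 0" if "i = 1 \<or> i = 2" for i
  proof -
    have "{A \<in> F. card A = i} = {}" using member_card_ge_3 that by fastforce
    then show ?thesis by (simp only: a_def card.empty)
  qed
  have above: "a i = 0" if "card V < i" for i
  proof -
    have "{A \<in> F. card A = i} = {}" using cardV that by fastforce
    then show ?thesis by (simp only: a_def card.empty)
  qed
  have top: "a (card V) = 1"
  proof -
    have "{A \<in> F. card A = card V} = {V}"
      using V_in_F card_subset_eq[OF finite_Union] by blast
    then show ?thesis by (simp add: a_def)
  qed
  have a1: "a (Suc 0) = 0" and a2: "a (Suc (Suc 0)) = 0" using a12 by auto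
  have "card F = (\<Sum>i\<le>8. a i)"
    using sum_by_card[OF finite_F card8, of "\<lambda>_. 1"] by (simp add: a_def)
  then have m: "card F = a 0 + a 3 + a 4 + a 5 + a 6 + a 7 + a 8"
    by (simp add: eval_nat_numeral a1 a2)
  have "2 * (\<Sum>A\<in>F. card A) = (\<Sum>x\<in>V. 2 * freq F x)"
    using sum_card_eq_sum_freq[OF finite_F finite_Union] by (simp add: sum_distrib_left Union_upper)
  also have "\<dots> \<le> (\<Sum>x\<in>V. card F - 1)"
    using rare by (intro sum_mono) fastforce
  finally have "2 * (\<Sum>A\<in>F. card A) \<le> card V * (card F - 1)" by simp
  moreover have "(\<Sum>A\<in>F. card A) = (\<Sum>i\<le>8. i * a i)"
    using sum_by_card[OF finite_F card8, of "\<lambda>i. i"] by (simp add: a_def)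
  then have "(\<Sum>A\<in>F. card A) = 3 * a 3 + 4 * a 4 + 5 * a 5 + 6 * a 6 + 7 * a 7 + 8 * a 8"
    by (simp add: eval_nat_numeral a1 a2)
  ultimately have w: "2 * (3 * a 3 + 4 * a 4 + 5 * a 5 + 6 * a 6 + 7 * a 7 + 8 * a 8)
      \<le> card V * (card F - 1)" by simp
  have pairs: "a 3 * (a 3 - 1) \<le> 2 * a 4 + 15 * a 5 + 20 * a 6"
    using triple_pairs[OF n8] by (simp add: a_def)
  have "3 \<le> card V" using member_card_ge_3[OF V_in_F V_nonempty] .
  then consider "card V = 3" | "card V = 4" | "card V = 5" | "card V = 6" | "card V = 7" | "card V = 8"
    using n8 by linarith
  then show False
  proof cases
    case 5
    then have "a 8 = 0" "a 7 = 1" using above[of 8] top by auto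
    then have A3: "7 + a 4 + 3 * a 5 + 5 * a 6 \<le> a 3" using w 5 m a0 by auto
    \<comment> \<open>By \<open>A3\<close>, \<open>6 * a 3\<close> is at least
      \<open>42 + 6 * a 4 + 18 * a 5 + 30 * a 6\<close>, more than \<open>pairs\<close>
      allows.\<close>
    then have "a 3 * 6 \<le> a 3 * (a 3 - 1)" by (intro mult_left_mono) auto
    then show False using pairs A3 by linarith
  next
    case 6
    then have a8: "a 8 = 1" using top by auto
    then have A3: "4 + a 5 + 2 * a 6 + 3 * a 7 \<le> a 3" using w 6 m a0 by auto
    have a7: "1 \<le> a 7" "6 \<le> a 5 + 2 * a 6 + 3 * a 7"
      using large_members[OF 6] by (simp_all add: a_def)
    then have "10 \<le> a 3" using A3 by linarith
    then obtain j where j: "a 3 = 10 + j" using le_Suc_ex by blast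
    then have "90 + 19 * j \<le> a 3 * (a 3 - 1)" by (simp add: algebra_simps)
    \<comment> \<open>\<open>A3\<close> and \<open>a7\<close> give
      \<open>a 5 + 2 * a 6 \<le> 3 + j\<close>, and \<open>card_le_36\<close> gives
      \<open>a 4 + a 5 + a 6 \<le> 24 - j\<close>. So the right side of \<open>pairs\<close> is at
      most \<open>2 * (24 - j) + 13 * (3 + j) = 87 + 11 * j\<close>.\<close>
    then show False using pairs A3 a7 j m a8 card_le_36 by linarith
  \<comment> \<open>With at most six elements, every nonempty member has at least half of them and
    \<open>V\<close> makes up for the empty set, so averaging suffices.\<close>
  qed (use w m a0 top above[of 4] above[of 5] above[of 6] above[of 7] above[of 8] in auto)
qed

subsection \<open>Nine elements\<close>

text \<open>\<open>9 \<le> card V\<close> forces \<open>17 \<le> freq F x\<close>, and rarity with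
  \<open>card_le_36\<close> forces \<open>freq F x \<le> 17\<close>.\<close>

lemma tight:
  assumes "undominated x"
  shows "card V = 9" "freq F x = 17"
proof -
  have "2 * freq F x < card F" using rare undominatedD(1)[OF assms] by blast
  then show "card V = 9" "freq F x = 17"
    using freq_undominated_ge[OF assms] card_V_ge_9 card_le_36 by linarith+
qed

text \<open>An undominated \<open>w\<close> above \<open>v\<close> has frequency 17 and shares at
  least 8 members with \<open>x\<close>.\<close>

lemma card_avoiding_le_9:
  assumes "undominated x" "v \<in> V"
  shows "card {A \<in> F. x \<notin> A \<and> v \<in> A} \<le> 9"
proof (cases "{A \<in> F. x \<notin> A \<and> v \<in> A} = {}")
  case True
  then show ?thesis by (simp only: card.empty)
next
  case False
  obtain w where w: "undominated w" "{A \<in> F. v \<in> A} \<subseteq> {A \<in> F. w \<in> A}"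
    using ex_undominated_above[OF assms(2)] .
  have "x \<noteq> w" using False w(2) by blast
  then have "8 \<le> card {A \<in> F. x \<in> A \<and> w \<in> A}"
    using common_members(3)[OF assms(1) w(1)] tight(1)[OF w(1)] by simp
  moreover have "card {A \<in> F. x \<notin> A \<and> v \<in> A} \<le> card {A \<in> F. x \<notin> A \<and> w \<in> A}"
    using finite_F w(2) by (intro card_mono) auto
  ultimately show ?thesis using freq_split[of w x] tight(2)[OF w(1)] by linarith
qed

text \<open>The union \<open>r \<union> p\<close> is a further member containing \<open>s\<close> and \<open>x\<close> but not \<open>y\<close>.\<close>

lemma card_outer_containing:
  assumes "undominated y" "v \<in> V" "s \<in> V"
    and "card {A \<in> F. x \<in> A \<and> y \<notin> A} = 9"
    and "p \<in> F" "x \<in> p" "y \<notin> p" "v \<notin> p"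
    and "r \<in> F" "x \<notin> r" "y \<notin> r" "v \<in> r"
    and s: "\<And>p. \<lbrakk>p \<in> F; x \<in> p; y \<notin> p; v \<notin> p\<rbrakk> \<Longrightarrow> s \<in> p"
  shows "card {A \<in> F. x \<notin> A \<and> y \<notin> A \<and> s \<in> A} + card {A \<in> F. x \<notin> A \<and> y \<notin> A \<and> v \<in> A} \<le> 8"
proof -
  have split: "card {A \<in> F. y \<notin> A \<and> u \<in> A} =
      card {A \<in> F. x \<in> A \<and> y \<notin> A \<and> u \<in> A} + card {A \<in> F. x \<notin> A \<and> y \<notin> A \<and> u \<in> A}" for u
    using finite_F by (subst card_Un_disjoint[symmetric]) (auto intro!: arg_cong[where f=card])
  have "card {A \<in> F. x \<in> A \<and> y \<notin> A} =
      card {A \<in> F. x \<in> A \<and> y \<notin> A \<and> v \<in> A} + card {A \<in> F. x \<in> A \<and> y \<notin> A \<and> v \<notin> A}"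
    using finite_F by (subst card_Un_disjoint[symmetric]) (auto intro!: arg_cong[where f=card])
  moreover have "Suc (card {A \<in> F. x \<in> A \<and> y \<notin> A \<and> v \<notin> A}) \<le> card {A \<in> F. x \<in> A \<and> y \<notin> A \<and> s \<in> A}"
  proof -
    have "insert (r \<union> p) {A \<in> F. x \<in> A \<and> y \<notin> A \<and> v \<notin> A} \<subseteq> {A \<in> F. x \<in> A \<and> y \<notin> A \<and> s \<in> A}"
      using assms union_closedD[OF union_closed] by auto
    from card_mono[OF _ this] show ?thesis using finite_F assms(12) by simp
  qed
  \<comment> \<open>\<open>v\<close> and \<open>s\<close> together occur at least 10 times among the
    members containing \<open>x\<close> but not \<open>y\<close>, and each lies in at most 9 members
    avoiding \<open>y\<close>; this leaves at most 18 - 10.\<close>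
  ultimately show ?thesis
    using card_avoiding_le_9[OF assms(1,2)] card_avoiding_le_9[OF assms(1,3)] split[of v] split[of s] assms(4)
    by linarith
qed

lemma no_minimal_counterexample: False
proof -
  obtain x where x: "undominated x" using ex_undominated .
  obtain y where y: "undominated y" "y \<noteq> x"
    "card F \<le> freq F x + 2 * card {A \<in> F. x \<notin> A \<and> y \<in> A}"
    using ex_partner[OF x] by blast
  have xyV: "x \<in> V" "y \<in> V" using x y undominatedD by auto
  have V9: "card V = 9" using tight(1)[OF x] .
  let ?R = "{A \<in> F. x \<notin> A \<and> y \<notin> A}"
  have "34 < card F" using rare[OF xyV(1)] tight(2)[OF x] by simp
  then have ny: "9 \<le> card {A \<in> F. x \<notin> A \<and> y \<in> A}" using y(3) tight(2)[OF x] by linarith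
  have Q9: "card {A \<in> F. x \<notin> A \<and> y \<in> A} = 9"
    using ny card_avoiding_le_9[OF x xyV(2)] by linarith
  have common8: "card {A \<in> F. x \<in> A \<and> y \<in> A} = 8"
    using freq_split[of y x] tight(2)[OF y(1)] Q9 by linarith
  have P9: "card {A \<in> F. y \<notin> A \<and> x \<in> A} = 9"
    using freq_split[of x y] tight(2)[OF x] common8 by (simp add: conj_commute)
  have "card {A \<in> F. x \<notin> A} = card {A \<in> F. x \<notin> A \<and> y \<in> A} + card ?R"
    using finite_F by (subst card_Un_disjoint[symmetric]) (auto intro!: arg_cong[where f=card])
  then have "card F = freq F x + (card {A \<in> F. x \<notin> A \<and> y \<in> A} + card ?R)"
    using card_F_split[of "\<lambda>A. x \<in> A"] by (simp add: freq_def)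
  \<comment> \<open>\<open>y(3)\<close> now gives \<open>card F \<le> 17 + 18\<close>, so
    \<open>card F = 35\<close> and 35 - 17 - 9 members are left.\<close>
  then have R9: "card ?R = 9"
    using Q9 tight(2)[OF x] y(3) \<open>34 < card F\<close> by linarith
  \<comment> \<open>The eight members known to contain both are already all of them.\<close>
  have common: "{A \<in> F. x \<in> A \<and> y \<in> A} = insert V (M ` (V - {x, y}))"
    using common_members[OF x y(1)] y(2) common8 V9 finite_F
    by (intro card_subset_eq[symmetric]) auto
  have R1: "?R \<subset> F" using xyV by blast
  have R2: "union_closed ?R" using union_closed by (auto simp: union_closed_def)
  have R3: "\<exists>A\<in>?R. A \<noteq> {}" using R9 card_mono[of "{{}}" ?R] by fastforce
  obtain v' where v': "v' \<in> \<Union>?R" "card ?R \<le> 2 * freq ?R v'"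
    using minimal[OF R1 R2 R3] by (rule bexE)
  then have "v' \<in> V" by blast
  then obtain v where v: "undominated v" "{A \<in> F. v' \<in> A} \<subseteq> {A \<in> F. v \<in> A}"
    by (rule ex_undominated_above)
  have vxy: "v \<in> V" "v \<noteq> x" "v \<noteq> y" using v v'(1) undominatedD by auto
  let ?\<gamma> = "card {A \<in> F. x \<notin> A \<and> y \<notin> A \<and> v \<in> A}"
  have "freq ?R v' \<le> ?\<gamma>" unfolding freq_def using finite_F v(2) by (intro card_mono) auto
  then have \<gamma>: "5 \<le> ?\<gamma>" using v'(2) R9 by linarith
  obtain r where r: "r \<in> F" "x \<notin> r" "y \<notin> r" "v \<in> r" using v v'(1) by blast
  let ?P = "{A \<in> F. x \<in> A \<and> y \<notin> A \<and> v \<notin> A}" and ?Q = "{A \<in> F. x \<notin> A \<and> y \<in> A \<and> v \<notin> A}"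
  \<comment> \<open>At most nine members avoiding \<open>d\<close> contain \<open>v\<close>, and at
    least five of those avoid \<open>c\<close> too; so \<open>v\<close> is in at most four of the
    nine members containing \<open>c\<close> but not \<open>d\<close>.\<close>
  have P5: "5 \<le> card {A \<in> F. c \<in> A \<and> d \<notin> A \<and> v \<notin> A}"
    if "undominated d" "card {A \<in> F. c \<in> A \<and> d \<notin> A} = 9" "{c, d} = {x, y}" for c d
  proof -
    have "card {A \<in> F. d \<notin> A \<and> v \<in> A} = card {A \<in> F. c \<in> A \<and> d \<notin> A \<and> v \<in> A} + ?\<gamma>"
      using finite_F that(3)
      by (subst card_Un_disjoint[symmetric]) (auto intro!: arg_cong[where f=card] simp: doubleton_eq_iff)
    moreover have "card {A \<in> F. c \<in> A \<and> d \<notin> A} =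
        card {A \<in> F. c \<in> A \<and> d \<notin> A \<and> v \<in> A} + card {A \<in> F. c \<in> A \<and> d \<notin> A \<and> v \<notin> A}"
      using finite_F by (subst card_Un_disjoint[symmetric]) (auto intro!: arg_cong[where f=card])
    ultimately show ?thesis using card_avoiding_le_9[OF that(1) vxy(1)] \<gamma> that(2) by linarith
  qed
  have cP: "5 \<le> card ?P" using P5[OF y(1), of x] P9 by (simp add: conj_commute)
  have cQ: "5 \<le> card ?Q" using P5[OF x, of y] Q9 by (simp add: conj_commute conj_left_commute insert_commute)
  \<comment> \<open>The union contains \<open>x\<close> and \<open>y\<close> but not
    \<open>v\<close>, so it is some \<open>M z\<close>; being undominated, \<open>v\<close> lies in
    every \<open>M z\<close> with \<open>z \<noteq> v\<close>.\<close>
  have union: "p \<union> q = M v" if "p \<in> ?P" "q \<in> ?Q" for p q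
  proof -
    have "p \<union> q \<in> {A \<in> F. x \<in> A \<and> y \<in> A}"
      using that union_closedD[OF union_closed, of p q] by auto
    then consider "p \<union> q = V" | z where "z \<in> V" "p \<union> q = M z" unfolding common by blast
    then show ?thesis
    proof cases
      case 1 then show ?thesis using that vxy(1) by blast
    next
      case 2
      then show ?thesis using undominatedD(2)[OF v(1), of z] that by blast
    qed
  qed
  let ?W = "V - {x, y, v}" and ?c = "\<lambda>A. M v - {x, y} - A"
  have W6: "card ?W = 6" using xyV vxy y(2) V9 finite_Union by (subst card_Diff_subset) auto
  have sub_M: "A \<subseteq> M v" if "A \<in> F" "v \<notin> A" for A using that by (auto simp: M_def)
  have inj: "inj_on ?c ?P" "inj_on ?c ?Q"
  proof -
    have "p \<subseteq> q" if "?c p = ?c q" "p \<inter> {x, y} = q \<inter> {x, y}" "p \<subseteq> M v" for p q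
      using that by blast
    then have eq: "p = q" if "?c p = ?c q" "p \<inter> {x, y} = q \<inter> {x, y}" "p \<subseteq> M v" "q \<subseteq> M v" for p q
      using that by (metis subset_antisym)
    show "inj_on ?c ?P"
    proof (rule inj_onI)
      fix p q assume pq: "p \<in> ?P" "q \<in> ?P" and e: "?c p = ?c q"
      have "p \<inter> {x, y} = {x}" "q \<inter> {x, y} = {x}" using pq by auto
      then show "p = q" using pq sub_M by (intro eq[OF e]) auto
    qed
    show "inj_on ?c ?Q"
    proof (rule inj_onI)
      fix p q assume pq: "p \<in> ?Q" "q \<in> ?Q" and e: "?c p = ?c q"
      have "p \<inter> {x, y} = {y}" "q \<inter> {x, y} = {y}" using pq by auto
      then show "p = q" using pq sub_M by (intro eq[OF e]) auto
    qed
  qed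
  \<comment> \<open>Complements in \<open>M v\<close> of members of \<open>?P\<close> and of \<open>?Q\<close> are disjoint; five sets need three
    points on each side, so both sides together fill all six elements of \<open>?W\<close>.\<close>
  have W: "\<Union>(?c ` ?P) \<union> \<Union>(?c ` ?Q) = ?W"
  proof (rule disjoint_families_cover)
    show "5 \<le> card (?c ` ?P)" "5 \<le> card (?c ` ?Q)"
      using cP cQ inj by (simp_all add: card_image)
    show "?c ` ?P \<subseteq> Pow ?W" "?c ` ?Q \<subseteq> Pow ?W"
      using M_subset[of v] not_in_M[of v] by auto
    fix c d assume "c \<in> ?c ` ?P" "d \<in> ?c ` ?Q"
    then show "c \<inter> d = {}" using union by blast
  qed (use W6 finite_Union in auto)
  have bound: "freq ?R s + ?\<gamma> \<le> 8" if "s \<in> ?W" for s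
  proof -
    have s: "s \<in> V" using that by blast
    have Rs: "freq ?R s = card {A \<in> F. x \<notin> A \<and> y \<notin> A \<and> s \<in> A}"
      by (simp add: freq_def conj_assoc)
    have "0 < card ?P" using cP by linarith
    then have "?P \<noteq> {}" unfolding card_gt_0_iff by (rule conjunct1)
    then obtain p where p: "p \<in> ?P" unfolding ex_in_conv[symmetric] by (rule exE)
    have "0 < card ?Q" using cQ by linarith
    then have "?Q \<noteq> {}" unfolding card_gt_0_iff by (rule conjunct1)
    then obtain q where q: "q \<in> ?Q" unfolding ex_in_conv[symmetric] by (rule exE)
    have "s \<in> \<Union>(?c ` ?P) \<union> \<Union>(?c ` ?Q)" unfolding W by (rule that)
    then show ?thesis
    proof (rule UnE)
      assume "s \<in> \<Union>(?c ` ?P)"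
      then obtain p0 where p0: "p0 \<in> ?P" "s \<in> ?c p0" by (rule UN_E)
      \<comment> \<open>\<open>p0\<close> misses \<open>s\<close>, but its union with any member of
        \<open>?Q\<close> is \<open>M v\<close>, which contains \<open>s\<close>. So
        \<open>card_outer_containing\<close> applies with \<open>x\<close> and \<open>y\<close>
        exchanged.\<close>
      have "s \<in> q" if "q \<in> F" "y \<in> q" "x \<notin> q" "v \<notin> q" for q
        using union[OF p0(1), of q] p0(2) that by blast
      then have "card {A \<in> F. y \<notin> A \<and> x \<notin> A \<and> s \<in> A} + card {A \<in> F. y \<notin> A \<and> x \<notin> A \<and> v \<in> A} \<le> 8"
        using Q9 q r by (intro card_outer_containing[OF x vxy(1) s, of y q r]) (auto simp: conj_commute)
      moreover have "{A \<in> F. y \<notin> A \<and> x \<notin> A \<and> u \<in> A} = {A \<in> F. x \<notin> A \<and> y \<notin> A \<and> u \<in> A}" for u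
        by blast
      ultimately show ?thesis unfolding Rs by simp
    next
      assume "s \<in> \<Union>(?c ` ?Q)"
      then obtain q0 where q0: "q0 \<in> ?Q" "s \<in> ?c q0" by (rule UN_E)
      have "s \<in> p" if "p \<in> F" "x \<in> p" "y \<notin> p" "v \<notin> p" for p
        using union[OF _ q0(1), of p] q0(2) that by blast
      then show ?thesis
        unfolding Rs using P9 p r
        by (intro card_outer_containing[OF y(1) vxy(1) s, of x p r]) (auto simp: conj_commute)
    qed
  qed
  have "{A \<in> ?R. x \<in> A} = {}" "{A \<in> ?R. y \<in> A} = {}" by blast+
  then have zero: "freq ?R x = 0" "freq ?R y = 0" unfolding freq_def by (simp_all only: card.empty)
  have "(\<Sum>A\<in>?R. card A) = (\<Sum>s\<in>V. freq ?R s)"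
    using finite_F finite_Union by (intro sum_card_eq_sum_freq) auto
  also have "\<dots> = (\<Sum>s\<in>insert v ?W. freq ?R s)"
    using finite_Union vxy(1) by (intro sum.mono_neutral_right) (auto simp: zero)
  also have "\<dots> = freq ?R v + (\<Sum>s\<in>?W. freq ?R s)"
    using finite_Union by simp
  also have "freq ?R v = ?\<gamma>" by (simp add: freq_def conj_assoc)
  also have "(\<Sum>s\<in>?W. freq ?R s) \<le> (\<Sum>s\<in>?W. 8 - ?\<gamma>)"
    using bound by (intro sum_mono) fastforce
  finally have "(\<Sum>A\<in>?R. card A) \<le> ?\<gamma> + 6 * (8 - ?\<gamma>)" using W6 by simp
  \<comment> \<open>For \<open>?\<gamma> \<le> 8\<close> the bound is
    \<open>48 - 5 * ?\<gamma> \<le> 23\<close>; at 9 the truncated difference is 0 and the bound is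
    9.\<close>
  moreover have "?\<gamma> \<le> 9"
    unfolding R9[symmetric] using finite_F by (intro card_mono) auto
  ultimately have upper: "(\<Sum>A\<in>?R. card A) \<le> 23"
    using \<gamma> by linarith
  \<comment> \<open>At least eight of the nine members are nonempty.\<close>
  have "8 * 3 \<le> card (?R - {{}}) * 3"
    using R9 card_Diff_subset[of "{{}}" ?R] by (cases "{} \<in> ?R") auto
  also have "\<dots> = (\<Sum>A\<in>?R - {{}}. 3)" by simp
  also have "\<dots> \<le> (\<Sum>A\<in>?R - {{}}. card A)"
    using member_card_ge_3 by (intro sum_mono) auto
  also have "\<dots> \<le> (\<Sum>A\<in>?R. card A)"
    using finite_F by (intro sum_mono2) auto
  finally show False using upper by simp
qed

end

section \<open>The induction\<close>

text \<open>Elements contained in the same members are merged by deleting one of them, which changes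
  neither the number of members nor the frequency of the other elements.\<close>

lemma abundant_element_le_36:
  assumes "finite (\<Union>F)" "union_closed F" "\<exists>A\<in>F. A \<noteq> {}" "card F \<le> 36"
  shows "\<exists>x\<in>\<Union>F. card F \<le> 2 * freq F x"
  using assms
\<comment> \<open>The sum drops both for a proper subfamily, whose union does not grow, and when an
  element is deleted without identifying members.\<close>
proof (induction "card F + card (\<Union>F)" arbitrary: F rule: less_induct)
  case less
  note IH = less.hyps
  have finF: "finite F" using less.prems(1) by (rule finite_UnionD)
  show ?case
  proof (rule ccontr)
    assume neg: "\<not> ?case"
    have sep: "x = y"
      if x: "x \<in> \<Union>F" and y: "y \<in> \<Union>F" and eq: "{A \<in> F. x \<in> A} = {A \<in> F. y \<in> A}" for x y
    proof (rule ccontr)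
      assume "x \<noteq> y"
      have same: "x \<in> A \<longleftrightarrow> y \<in> A" if "A \<in> F" for A using eq that by blast
      let ?f = "\<lambda>A. A - {y}"
      \<comment> \<open>Whether \<open>y\<close> was in a member can be read off from
        \<open>x\<close>, which is kept.\<close>
      have inj: "inj_on ?f F"
      proof (rule inj_onI)
        fix A B assume AB: "A \<in> F" "B \<in> F" "A - {y} = B - {y}"
        then have "y \<in> A \<longleftrightarrow> y \<in> B" using same[of A] same[of B] \<open>x \<noteq> y\<close> by blast
        then show "A = B" using AB(3) by blast
      qed
      have card_eq: "card (?f ` F) = card F" by (rule card_image[OF inj])
      have Un: "\<Union>(?f ` F) = \<Union>F - {y}" by blast
      have "card (\<Union>F - {y}) < card (\<Union>F)" by (rule card_Diff1_less[OF less.prems(1) y])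
      then have "card (?f ` F) + card (\<Union>(?f ` F)) < card F + card (\<Union>F)"
        unfolding Un card_eq by simp
      moreover have "finite (\<Union>(?f ` F))" unfolding Un using less.prems(1) by simp
      moreover have "union_closed (?f ` F)"
        unfolding union_closed_def
      proof (intro ballI)
        fix S T assume "S \<in> ?f ` F" "T \<in> ?f ` F"
        then obtain A B where "A \<in> F" "B \<in> F" "S = A - {y}" "T = B - {y}" by blast
        then show "S \<union> T \<in> ?f ` F"
          using union_closedD[OF less.prems(2), of A B] by (intro image_eqI[of _ _ "A \<union> B"]) auto
      qed
      moreover have "\<exists>A\<in>?f ` F. A \<noteq> {}" using x \<open>x \<noteq> y\<close> by blast
      moreover have "card (?f ` F) \<le> 36" unfolding card_eq by (rule less.prems(4))
      ultimately have "\<exists>z\<in>\<Union>(?f ` F). card (?f ` F) \<le> 2 * freq (?f ` F) z" by (rule IH)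
      then obtain z where z: "z \<in> \<Union>F" "z \<noteq> y" "card F \<le> 2 * freq (?f ` F) z"
        unfolding Un card_eq by blast
      have "{B \<in> ?f ` F. z \<in> B} = ?f ` {A \<in> F. z \<in> A}" using z(2) by auto
      then have "freq (?f ` F) z = freq F z"
        unfolding freq_def by (simp add: card_image inj_on_subset[OF inj])
      then show False using neg z by auto
    qed
    have "minimal_counterexample F"
    proof
      show "finite (\<Union>F)" "union_closed F" "\<exists>A\<in>F. A \<noteq> {}" "card F \<le> 36"
        using less.prems by auto
      show "2 * freq F x < card F" if "x \<in> \<Union>F" for x using neg that by (meson not_less)
      show "x = y" if "x \<in> \<Union>F" "y \<in> \<Union>F" "{A \<in> F. x \<in> A} = {A \<in> F. y \<in> A}" for x y
        by (rule sep[OF that])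
      fix G assume G: "G \<subset> F" "union_closed G" "\<exists>A\<in>G. A \<noteq> {}"
      have "card G < card F" by (rule psubset_card_mono[OF finF G(1)])
      moreover have sub: "\<Union>G \<subseteq> \<Union>F" using G(1) by blast
      moreover have "card (\<Union>G) \<le> card (\<Union>F)" by (rule card_mono[OF less.prems(1) sub])
      ultimately show "\<exists>x\<in>\<Union>G. card G \<le> 2 * freq G x"
        using less.prems(4) finite_subset[OF sub less.prems(1)] G by (intro IH) auto
    qed
    then show False by (rule minimal_counterexample.no_minimal_counterexample)
  qed
qed

theorem theorem10:
  fixes n m :: nat and \<A> :: "nat set set"
  assumes "\<A> \<subseteq> Pow {1..n}"
    and "union_closed \<A>"
    and "\<exists>A\<in>\<A>. A \<noteq> {}"
    and "card \<A> = m" and "m \<le> 36"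
  shows "\<exists>x\<in>{1..n}. real (card {A \<in> \<A>. x \<in> A}) \<ge> real m / 2"
proof -
  have sub: "\<Union>\<A> \<subseteq> {1..n}" using assms(1) by blast
  then have "finite (\<Union>\<A>)" using finite_subset by blast
  then obtain x where "x \<in> \<Union>\<A>" "card \<A> \<le> 2 * freq \<A> x"
    using abundant_element_le_36[of \<A>] assms by blast
  then show ?thesis
    using sub assms(4) unfolding freq_def by (intro bexI[of _ x]) auto
qed

end
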